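(* Let $R$ be a factorial domain, $f_1,\ldots,f_n,f\in R$ with some $f_i\neq 0$, and let $d$ be a greatest common divisor of $f_1,\ldots,f_n$ and $f$. Let $B=R[T_1,\ldots,T_n]$, let $$h=f_1T_1+\cdots+f_nT_n+f=d\,(f_1'T_1+\cdots+f_n'T_n+f')$$ be the forcing equation (so $f_i'=f_i/d$, $f'=f/d$), and let $d=p_1\cdots p_k$ be a prime factorization of $d$. Suppose that $\{1,\ldots,k\}=\biguplus_{i\in I}J_i$ is a partition such that the sets $\bigcup_{j\in J_i}V(p_j)$, $i\in I$, are the connected components of $V(d)$. Then $\operatorname{Spec} B/(h)$ is connected if and only if for every $i\in I$ there exists some $j\in J_i$ such that $(f_1'T_1+\cdots+f_n'T_n+f',\,p_j)\neq(1)$ in $B$.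
   Context: A factorial domain is a unique factorization domain (not assumed noetherian). $V(d)$ and $V(p_j)$ denote closed subsets of $\operatorname{Spec} R$. The empty topological space is not considered connected. Here $I$ is just an index set. *)

theory Defs
  imports
    "HOL-Analysis.Analysis"
    "HOL-Algebra.Algebraic_Closure_Type"
    "HOL-Library.Poly_Mapping"
    "HOL-Computational_Algebra.Factorial_Ring"
begin

section \<open>The Zariski topology\<close>

definition Spec :: "('a, 'b) ring_scheme \<Rightarrow> 'a set set"
  where "Spec R = {P. primeideal P R}"

definition vanishing_set :: "('a, 'b) ring_scheme \<Rightarrow> 'a set \<Rightarrow> 'a set set"
  where "vanishing_set R E = {P \<in> Spec R. E \<subseteq> P}"

definition zariski :: "('a, 'b) ring_scheme \<Rightarrow> 'a set topology"
  where "zariski R = topology (\<lambda>U. \<exists>E \<subseteq> carrier R. U = Spec R - vanishing_set R E)"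

lemma istopology_zariski:
  fixes R :: "('a, 'b) ring_scheme"
  shows "istopology (\<lambda>U. \<exists>E \<subseteq> carrier R. U = Spec R - vanishing_set R E)"
  unfolding istopology_def
proof (intro conjI allI impI)
  fix S T :: "'a set set"
  assume "\<exists>E \<subseteq> carrier R. S = Spec R - vanishing_set R E"
    and "\<exists>E \<subseteq> carrier R. T = Spec R - vanishing_set R E"
  then obtain E F where E: "E \<subseteq> carrier R" "S = Spec R - vanishing_set R E"
    and F: "F \<subseteq> carrier R" "T = Spec R - vanishing_set R F" by blast
  show "\<exists>E \<subseteq> carrier R. S \<inter> T = Spec R - vanishing_set R E"
  proof (cases "Spec R = {}")
    case True
    then show ?thesis using E F by blast
  next
    case False
    then obtain P0 where "primeideal P0 R" by (auto simp: Spec_def)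
    then interpret cring R by (simp add: primeideal_def)
    let ?G = "{e \<otimes>\<^bsub>R\<^esub> f | e f. e \<in> E \<and> f \<in> F}"
    have "?G \<subseteq> P \<longleftrightarrow> E \<subseteq> P \<or> F \<subseteq> P" if "primeideal P R" for P
    proof -
      interpret primeideal P R by fact
      show ?thesis
        using E(1) F(1) I_prime by (auto intro: I_l_closed I_r_closed) blast
    qed
    then have "vanishing_set R ?G = vanishing_set R E \<union> vanishing_set R F"
      unfolding vanishing_set_def Spec_def by blast
    then have "S \<inter> T = Spec R - vanishing_set R ?G"
      unfolding E F by (simp only: Diff_Un)
    moreover have "?G \<subseteq> carrier R" using E F by auto
    ultimately show ?thesis by blast
  qed
next
  fix K :: "'a set set set"
  assume "\<forall>S\<in>K. \<exists>E \<subseteq> carrier R. S = Spec R - vanishing_set R E"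
  then obtain E where E: "\<And>S. S \<in> K \<Longrightarrow> E S \<subseteq> carrier R \<and> S = Spec R - vanishing_set R (E S)"
    by metis
  have "\<Union> K = (\<Union>S\<in>K. Spec R - vanishing_set R (E S))" using E by blast
  also have "\<dots> = Spec R - vanishing_set R (\<Union>(E ` K))"
    unfolding vanishing_set_def by blast
  finally have "\<Union> K = Spec R - vanishing_set R (\<Union>(E ` K))" .
  moreover have "\<Union>(E ` K) \<subseteq> carrier R" using E by blast
  ultimately show "\<exists>E \<subseteq> carrier R. \<Union> K = Spec R - vanishing_set R E" by blast
qed

lemma openin_zariski:
  "openin (zariski R) U \<longleftrightarrow> (\<exists>E \<subseteq> carrier R. U = Spec R - vanishing_set R E)"
  unfolding zariski_def by (simp add: topology_inverse' istopology_zariski)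

lemma topspace_zariski: "topspace (zariski R) = Spec R"
proof
  show "topspace (zariski R) \<subseteq> Spec R"
    unfolding topspace_def openin_zariski by blast
  have "Spec R = Spec R - vanishing_set R (carrier R)"
    unfolding vanishing_set_def Spec_def
    by (auto simp: primeideal_def primeideal_axioms_def ideal_def
        dest: additive_subgroup.a_subset)
  then show "Spec R \<subseteq> topspace (zariski R)"
    by (metis openin_subset openin_zariski order_refl)
qed


section \<open>Polynomials in finitely many variables\<close>

text \<open>
  \<^typ>\<open>(nat \<Rightarrow>\<^sub>0 nat) \<Rightarrow>\<^sub>0 'a\<close> is the polynomial ring in countably many variables over
  \<^typ>\<open>'a\<close>: it maps a monomial, given by its exponents, to its coefficient.
  The ring in \<open>T\<^sub>1, \<dots>, T\<^sub>n\<close> is the subring of those polynomials in which no other variable occurs.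
\<close>

definition mpoly_ring :: "nat \<Rightarrow> ((nat \<Rightarrow>\<^sub>0 nat) \<Rightarrow>\<^sub>0 'a::comm_ring_1) ring"
  where "mpoly_ring n = ring_of_type_algebra
    \<lparr>carrier := {q. \<forall>m \<in> Poly_Mapping.keys q. Poly_Mapping.keys m \<subseteq> {1..n}}\<rparr>"

definition mpoly_const :: "'a::comm_ring_1 \<Rightarrow> (nat \<Rightarrow>\<^sub>0 nat) \<Rightarrow>\<^sub>0 'a"
  where "mpoly_const c = Poly_Mapping.single 0 c"

definition mpoly_var :: "nat \<Rightarrow> (nat \<Rightarrow>\<^sub>0 nat) \<Rightarrow>\<^sub>0 'a::comm_ring_1"
  where "mpoly_var i = Poly_Mapping.single (Poly_Mapping.single i 1) 1"

definition forcing_poly ::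
    "nat \<Rightarrow> (nat \<Rightarrow> 'a::comm_ring_1) \<Rightarrow> 'a \<Rightarrow> (nat \<Rightarrow>\<^sub>0 nat) \<Rightarrow>\<^sub>0 'a"
  where "forcing_poly n f g = (\<Sum>i = 1..n. mpoly_const (f i) * mpoly_var i) + mpoly_const g"

lemma mpoly_ring_simps:
  "x \<otimes>\<^bsub>mpoly_ring n\<^esub> y = x * y" "x \<oplus>\<^bsub>mpoly_ring n\<^esub> y = x + y"
  "\<one>\<^bsub>mpoly_ring n\<^esub> = 1" "\<zero>\<^bsub>mpoly_ring n\<^esub> = 0"
  "x \<in> carrier (mpoly_ring n) \<longleftrightarrow>
    (\<forall>m \<in> Poly_Mapping.keys x. Poly_Mapping.keys m \<subseteq> {1..n})"
  by (simp_all add: mpoly_ring_def ring_of_type_algebra_def)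

lemma cring_mpoly_ring: "cring (mpoly_ring n :: ((nat \<Rightarrow>\<^sub>0 nat) \<Rightarrow>\<^sub>0 'a::comm_ring_1) ring)"
proof -
  let ?B = "mpoly_ring n :: ((nat \<Rightarrow>\<^sub>0 nat) \<Rightarrow>\<^sub>0 'a) ring"
  have add: "x + y \<in> carrier ?B" if "x \<in> carrier ?B" "y \<in> carrier ?B" for x y
    using that keys_add[of x y] unfolding mpoly_ring_simps by blast
  have mult: "x * y \<in> carrier ?B" if "x \<in> carrier ?B" "y \<in> carrier ?B" for x y
    unfolding mpoly_ring_simps
  proof
    fix m assume "m \<in> Poly_Mapping.keys (x * y)"
    then obtain a b where "a \<in> Poly_Mapping.keys x" "b \<in> Poly_Mapping.keys y" "m = a + b"
      using keys_mult[of x y] by blast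
    then show "Poly_Mapping.keys m \<subseteq> {1..n}"
      using that keys_add[of a b] unfolding mpoly_ring_simps by blast
  qed
  have neg: "- x \<in> carrier ?B" if "x \<in> carrier ?B" for x
    using that unfolding mpoly_ring_simps by simp
  have one: "1 \<in> carrier ?B" "0 \<in> carrier ?B" unfolding mpoly_ring_simps by simp_all
  show ?thesis
  proof (rule cringI)
    show "abelian_group ?B"
    proof (rule abelian_groupI)
      fix x assume "x \<in> carrier ?B"
      then show "\<exists>y\<in>carrier ?B. y \<oplus>\<^bsub>?B\<^esub> x = \<zero>\<^bsub>?B\<^esub>"
        using neg by (intro bexI[of _ "- x"]) (simp_all add: mpoly_ring_simps(1-4))
    qed (use add one in \<open>simp_all add: mpoly_ring_simps(1-4) ac_simps\<close>)
    show "comm_monoid ?B"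
      by (rule comm_monoidI) (use mult one in \<open>simp_all add: mpoly_ring_simps(1-4) ac_simps\<close>)
  qed (simp add: mpoly_ring_simps(1-4) algebra_simps)
qed

lemma mpoly_const_in_carrier: "mpoly_const c \<in> carrier (mpoly_ring n)"
  by (simp add: mpoly_ring_simps mpoly_const_def)

lemma forcing_poly_in_carrier: "forcing_poly n f g \<in> carrier (mpoly_ring n)"
proof -
  interpret cring "mpoly_ring n :: ((nat \<Rightarrow>\<^sub>0 nat) \<Rightarrow>\<^sub>0 'a) ring" by (rule cring_mpoly_ring)
  have "(\<Sum>i \<in> A. mpoly_const (f i) * mpoly_var i) \<in> carrier (mpoly_ring n)"
    if "A \<subseteq> {1..n}" for A
    using finite_subset[OF that finite_atLeastAtMost] that
  proof (induction A rule: finite_induct)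
    case (insert i A)
    have "mpoly_var i \<in> carrier (mpoly_ring n)"
      using insert.prems by (simp add: mpoly_ring_simps mpoly_var_def)
    then have "mpoly_const (f i) * mpoly_var i \<in> carrier (mpoly_ring n)"
      using m_closed[OF mpoly_const_in_carrier] by (simp only: mpoly_ring_simps(1))
    moreover have "(\<Sum>i \<in> A. mpoly_const (f i) * mpoly_var i) \<in> carrier (mpoly_ring n)"
      using insert by simp
    ultimately show ?case
      using a_closed insert.hyps by (simp add: mpoly_ring_simps(2))
  qed (use zero_closed in \<open>simp add: mpoly_ring_simps(4)\<close>)
  from this[OF order_refl] show ?thesis
    unfolding forcing_poly_def
    using a_closed[OF _ mpoly_const_in_carrier] by (simp only: mpoly_ring_simps(2))
qed

end

theory Submission
  imports Defs
begin

text \<open>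
  Write \<open>h'\<close> for \<open>f\<^sub>1' T\<^sub>1 + \<dots> + f\<^sub>n' T\<^sub>n + f'\<close>, so that \<open>h = d h'\<close>. The spectrum of \<open>B/(h)\<close> is the closed
  subset \<open>V(h) = V(h') \<union> V(d)\<close> of \<open>Spec B\<close> (\<open>homeomorphic_map_Spec_quotient\<close>).

  The first part \<open>V(h')\<close> is irreducible and nonempty. Indeed the coefficients of \<open>h'\<close> have no common
  prime factor and \<open>h'\<close> is linear and not constant, hence it is a prime element of \<open>B\<close>
  (\<open>primitive_forcing_poly_prime\<close>). The proof avoids the theorem that polynomial rings over factorial
  domains are factorial: it divides by \<open>h'\<close> with respect to one variable up to powers of a constant,
  and removes that constant by Gauss's lemma.

  The second part is the preimage of \<open>V(d) \<subseteq> Spec R\<close> under the projection \<open>Spec B \<rightarrow> Spec R\<close>. The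
  preimages of the connected components of \<open>V(d)\<close> are pairwise disjoint, closed and finite
  in number. They are also connected (\<open>connectedin_preimage_union_vanishing_sets\<close>): the preimage of each \<open>V(p\<^sub>j)\<close> is
  irreducible, and the zero section embeds the whole component as a connected set that meets them all.

  So \<open>V(h)\<close> is a connected set with finitely many disjoint connected closed sets attached to it, and
  such a union is connected iff each of these sets meets \<open>V(h')\<close>
  (\<open>connectedin_Un_disjoint_closed_iff\<close>). The preimage of the \<open>i\<close>-th component meets \<open>V(h')\<close> iff
  \<open>V(h', p\<^sub>j) \<noteq> {}\<close> for some \<open>j \<in> J i\<close>, which by the existence of maximal ideals means that \<open>h'\<close> and
  \<open>p\<^sub>j\<close> do not generate the unit ideal (\<open>vanishing_set_eq_empty_iff\<close>).
\<close>

section \<open>Connectedness of a set with finitely many closed sets attached\<close>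

text \<open>
  A member of \<open>K\<close> that misses \<open>S\<close> is closed, and so is the union of \<open>S\<close> with the other members,
  because there are only finitely many; so it splits off. Conversely every member that meets \<open>S\<close>
  forms a connected set together with \<open>S\<close>, and all these sets share \<open>S\<close>.
\<close>

lemma connectedin_Un_disjoint_closed_iff:
  assumes S: "connectedin Z S" "closedin Z S" "S \<noteq> {}"
    and "finite K"
    and K: "\<And>C. C \<in> K \<Longrightarrow> connectedin Z C" "\<And>C. C \<in> K \<Longrightarrow> closedin Z C" "\<And>C. C \<in> K \<Longrightarrow> C \<noteq> {}"
    and "pairwise disjnt K"
  shows "connectedin Z (S \<union> \<Union>K) \<longleftrightarrow> (\<forall>C\<in>K. C \<inter> S \<noteq> {})"
proof
  assume conn: "connectedin Z (S \<union> \<Union>K)"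
  show "\<forall>C\<in>K. C \<inter> S \<noteq> {}"
  proof (rule ccontr)
    assume "\<not> (\<forall>C\<in>K. C \<inter> S \<noteq> {})"
    then obtain C where C: "C \<in> K" "C \<inter> S = {}" by blast
    let ?D = "S \<union> \<Union>(K - {C})"
    have "closedin Z ?D"
      using S(2) K(2) \<open>finite K\<close> by (intro closedin_Un closedin_Union) auto
    moreover have "C \<inter> ?D = {}"
      using C \<open>pairwise disjnt K\<close> unfolding pairwise_def disjnt_def by blast
    moreover have "S \<union> \<Union>K \<subseteq> C \<union> ?D" by blast
    moreover have "C \<inter> (S \<union> \<Union>K) \<noteq> {}" using K(3)[OF C(1)] C(1) by blast
    moreover have "?D \<inter> (S \<union> \<Union>K) \<noteq> {}" using S(3) by blast
    ultimately show False
      using conn K(2)[OF C(1)] unfolding connectedin_closedin by (metis inf_bot_left)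
  qed
next
  assume meet: "\<forall>C\<in>K. C \<inter> S \<noteq> {}"
  have "connectedin Z (\<Union>(insert S ((\<lambda>C. S \<union> C) ` K)))"
    using S(1,3) K(1) meet by (intro connectedin_Union) (auto intro!: connectedin_Un)
  moreover have "\<Union>(insert S ((\<lambda>C. S \<union> C) ` K)) = S \<union> \<Union>K" by blast
  ultimately show "connectedin Z (S \<union> \<Union>K)" by simp
qed

section \<open>Closed subsets of a prime spectrum\<close>

lemma closedin_zariski:
  "closedin (zariski R) C \<longleftrightarrow> (\<exists>E \<subseteq> carrier R. C = vanishing_set R E)"
proof
  assume "closedin (zariski R) C"
  then obtain E where "E \<subseteq> carrier R" "C \<subseteq> Spec R" "Spec R - C = Spec R - vanishing_set R E"
    unfolding closedin_def topspace_zariski openin_zariski by blast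
  moreover have "vanishing_set R E \<subseteq> Spec R" by (auto simp: vanishing_set_def)
  ultimately show "\<exists>E \<subseteq> carrier R. C = vanishing_set R E" by blast
next
  assume "\<exists>E \<subseteq> carrier R. C = vanishing_set R E"
  then show "closedin (zariski R) C"
    unfolding closedin_def topspace_zariski openin_zariski by (auto simp: vanishing_set_def)
qed

text \<open>
  The point \<open>P\<close> is generic in \<open>V(P)\<close>: a closed set that contains it contains all primes above it.
  Hence \<open>V(P)\<close> lies in the closure of a single point.
\<close>

lemma connectedin_vanishing_set_primeideal:
  assumes "primeideal P R"
  shows "connectedin (zariski R) (vanishing_set R P)"
proof (rule connectedin_intermediate_closure_of)
  show "connectedin (zariski R) {P}"
    using assms by (simp add: topspace_zariski Spec_def)
  interpret primeideal P R by fact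
  show "{P} \<subseteq> vanishing_set R P"
    using assms by (simp add: vanishing_set_def Spec_def)
  show "vanishing_set R P \<subseteq> Abstract_Topology.closure_of (zariski R) {P}"
    unfolding closure_of_def openin_zariski topspace_zariski
    by (auto simp: vanishing_set_def Spec_def assms)
qed

lemma vanishing_set_genideal:
  assumes "cring R" "E \<subseteq> carrier R"
  shows "vanishing_set R (Idl\<^bsub>R\<^esub> E) = vanishing_set R E"
proof -
  interpret cring R by fact
  show ?thesis
    using genideal_self[OF assms(2)] genideal_minimal
    unfolding vanishing_set_def Spec_def primeideal_def by blast
qed

text \<open>
  Krull's theorem. Zorn's lemma applies to the ideals that avoid \<open>\<one>\<close>, since this
  condition, unlike properness stated as an inequality of sets, visibly passes to unions of chains.
\<close>

lemma (in cring) ideal_subset_maximalideal: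
  assumes "ideal I R" "I \<noteq> carrier R"
  obtains M where "maximalideal M R" "I \<subseteq> M"
proof -
  let ?A = "{J. ideal J R \<and> I \<subseteq> J \<and> \<one> \<notin> J}"
  have sub: "J \<subseteq> carrier R" if "ideal J R" for J
    using that by (simp add: ideal_def additive_subgroup.a_subset)
  have one: "J = carrier R \<longleftrightarrow> \<one> \<in> J" if "ideal J R" for J
    using ideal.one_imp_carrier[OF that] by auto
  have "\<exists>M\<in>?A. \<forall>Z\<in>?A. M \<subseteq> Z \<longrightarrow> Z = M"
  proof (rule subset_Zorn_nonempty)
    show "?A \<noteq> {}" using assms one by blast
    fix C assume C: "C \<noteq> {}" "subset.chain ?A C"
    then have "subset.chain {J. ideal J R} C"
      unfolding subset_chain_def by auto
    then have "ideal (\<Union>C) R"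
      using chain_Union_is_ideal[of C] C(1) by simp
    then show "\<Union>C \<in> ?A"
      using C unfolding subset_chain_def by blast
  qed
  then obtain M where "M \<in> ?A" and max: "\<forall>J\<in>?A. M \<subseteq> J \<longrightarrow> J = M"
    by (elim bexE)
  then have M: "ideal M R" "I \<subseteq> M" "\<one> \<notin> M" by simp_all
  have "maximalideal M R"
  proof (rule maximalidealI)
    show "carrier R \<noteq> M" using M by auto
    fix J assume "ideal J R" "M \<subseteq> J"
    then show "J = M \<or> J = carrier R" using max M(2) one by blast
  qed fact
  with M(2) show ?thesis by (rule that[rotated])
qed

lemma vanishing_set_eq_empty_iff:
  fixes R (structure)
  assumes "cring R" "E \<subseteq> carrier R"
  shows "vanishing_set R E = {} \<longleftrightarrow> Idl\<^bsub>R\<^esub> E = carrier R"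
proof
  interpret cring R by fact
  assume "vanishing_set R E = {}"
  then have none: "\<not> Idl E \<subseteq> P" if "primeideal P R" for P
    using that vanishing_set_genideal[OF assms] unfolding vanishing_set_def Spec_def by blast
  show "Idl E = carrier R"
  proof (rule ccontr)
    assume "Idl E \<noteq> carrier R"
    then obtain M where "maximalideal M R" "Idl E \<subseteq> M"
      using ideal_subset_maximalideal genideal_ideal[OF assms(2)] by blast
    then show False using none maximalideal_prime by blast
  qed
next
  assume "Idl\<^bsub>R\<^esub> E = carrier R"
  then have "vanishing_set R E = vanishing_set R (carrier R)"
    using vanishing_set_genideal[OF assms] by simp
  moreover have "\<not> carrier R \<subseteq> P" if "primeideal P R" for P
    using primeideal.I_notcarr[OF that] ideal.Icarr[OF primeideal.axioms(1)[OF that]] by blast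
  ultimately show "vanishing_set R E = {}"
    unfolding vanishing_set_def Spec_def by blast
qed

section \<open>Induced maps and spectra of quotient rings\<close>

text \<open>
  The map \<open>Spec B \<rightarrow> Spec A\<close> induced by \<open>\<phi> : A \<rightarrow> B\<close>. The values of \<open>\<phi>\<close> outside \<open>A\<close>
  are arbitrary, so the preimage is taken inside the carrier.
\<close>

definition Spec_map :: "('a, 'c) ring_scheme \<Rightarrow> ('a \<Rightarrow> 'b) \<Rightarrow> 'b set \<Rightarrow> 'a set"
  where "Spec_map A \<phi> P = {a \<in> carrier A. \<phi> a \<in> P}"

lemma Spec_map_in_Spec:
  assumes "cring A" "cring B" "\<phi> \<in> ring_hom A B" "P \<in> Spec B"
  shows "Spec_map A \<phi> P \<in> Spec A"
proof -
  interpret ring_hom_ring A B \<phi>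
    using assms by (intro ring_hom_ringI2) (auto simp: cring_def)
  show ?thesis
    using primeideal_vimage[OF assms(1)] assms(4) by (simp add: Spec_map_def Spec_def)
qed

text \<open>
  Preimages of closed sets are closed, with explicit equations; continuity of \<open>Spec_map\<close> and all
  later computations of preimages rest on this.
\<close>

lemma Spec_map_vanishing_set_iff:
  assumes "cring A" "cring B" "\<phi> \<in> ring_hom A B" "P \<in> Spec B" "E \<subseteq> carrier A"
  shows "Spec_map A \<phi> P \<in> vanishing_set A E \<longleftrightarrow> P \<in> vanishing_set B (\<phi> ` E)"
  using assms(4,5) Spec_map_in_Spec[OF assms(1-4)]
  by (auto simp: vanishing_set_def Spec_map_def)

lemma continuous_map_Spec_map:
  assumes "cring A" "cring B" "\<phi> \<in> ring_hom A B"
  shows "continuous_map (zariski B) (zariski A) (Spec_map A \<phi>)"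
  unfolding continuous_map_closedin topspace_zariski
proof (intro conjI allI impI Pi_I)
  fix P assume "P \<in> Spec B"
  then show "Spec_map A \<phi> P \<in> Spec A" by (rule Spec_map_in_Spec[OF assms])
next
  fix C assume "closedin (zariski A) C"
  then obtain E where E: "E \<subseteq> carrier A" "C = vanishing_set A E"
    unfolding closedin_zariski by blast
  have "{P \<in> Spec B. Spec_map A \<phi> P \<in> C} = vanishing_set B (\<phi> ` E)"
    unfolding E(2) using Spec_map_vanishing_set_iff[OF assms _ E(1)]
    by (auto simp: vanishing_set_def)
  moreover have "\<phi> ` E \<subseteq> carrier B"
    using E(1) ring_hom_closed[OF assms(3)] by blast
  ultimately show "closedin (zariski B) {P \<in> Spec B. Spec_map A \<phi> P \<in> C}"
    unfolding closedin_zariski by blast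
qed

text \<open>
  An ideal above \<open>I\<close> is a union of cosets of \<open>I\<close>, so membership can be tested in the quotient.
\<close>

lemma (in ideal) rcos_eq_in_superideal:
  assumes "ideal P R" "I \<subseteq> P" "a \<in> carrier R" "c \<in> P" "I +> a = I +> c"
  shows "a \<in> P"
proof -
  have "a \<in> I +> c" using a_rcos_self[OF assms(3)] assms(5) by simp
  then obtain i where "i \<in> I" "a = i \<oplus> c" unfolding a_r_coset_def' by auto
  then show ?thesis
    using assms(2,4) additive_subgroup.a_closed[OF ideal.axioms(1)[OF assms(1)]] by blast
qed

lemma (in cring) primeideal_quotient_image:
  assumes "ideal I R" "primeideal P R" "I \<subseteq> P"
  shows "primeideal ((+>) I ` P) (R Quot I)"
proof (rule primeidealI)
  interpret I: ideal I R by fact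
  interpret P: primeideal P R by fact
  show "ideal ((+>) I ` P) (R Quot I)"
    by (rule ring_ideal_imp_quot_ideal[OF assms(1) P.ideal_axioms])
  show "cring (R Quot I)" by (rule I.quotient_is_cring[OF is_cring])
  have mem: "a \<in> P" if "a \<in> carrier R" "I +> a \<in> (+>) I ` P" for a
    using that I.rcos_eq_in_superideal[OF P.ideal_axioms assms(3)] by blast
  have carr: "carrier (R Quot I) = (+>) I ` carrier R"
    by (auto simp: FactRing_simps)
  show "carrier (R Quot I) \<noteq> (+>) I ` P"
  proof
    assume "carrier (R Quot I) = (+>) I ` P"
    then have "\<one> \<in> P" using mem[of \<one>] carr by auto
    then show False using P.one_imp_carrier P.I_notcarr by blast
  qed
  fix x y assume "x \<in> carrier (R Quot I)" "y \<in> carrier (R Quot I)"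
    and xy: "x \<otimes>\<^bsub>R Quot I\<^esub> y \<in> (+>) I ` P"
  then obtain a b where ab: "a \<in> carrier R" "b \<in> carrier R" "x = I +> a" "y = I +> b"
    unfolding carr by blast
  then have "x \<otimes>\<^bsub>R Quot I\<^esub> y = I +> (a \<otimes> b)"
    by (simp add: FactRing_def I.rcoset_mult_add)
  then have "a \<otimes> b \<in> P" using mem[of "a \<otimes> b"] xy ab by simp
  then show "x \<in> (+>) I ` P \<or> y \<in> (+>) I ` P"
    using P.I_prime ab by blast
qed

text \<open>
  The inverse sends \<open>P\<close> to its image \<open>P/I\<close>. The map is closed because the primes of the quotient
  that contain \<open>E\<close> correspond to the primes that contain \<open>I\<close> and the preimage of \<open>E\<close>.
\<close>

lemma homeomorphic_map_Spec_quotient: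
  fixes R (structure)
  assumes "cring R" "ideal I R"
  shows "homeomorphic_map (zariski (R Quot I))
    (subtopology (zariski R) (vanishing_set R I)) (Spec_map R ((+>\<^bsub>R\<^esub>) I))"
proof -
  interpret cring R by fact
  interpret I: ideal I R by fact
  let ?Q = "R Quot I" and ?f = "Spec_map R ((+>) I)"
  have Q: "cring ?Q" by (rule I.quotient_is_cring[OF is_cring])
  have hom: "(+>) I \<in> ring_hom R ?Q" by (rule I.rcos_ring_hom)
  have carr: "carrier ?Q = (+>) I ` carrier R" by (auto simp: FactRing_simps)
  have image_f: "(+>) I ` ?f P = P" if "P \<in> Spec ?Q" for P
  proof -
    have "P \<subseteq> carrier ?Q"
      using that by (auto simp: Spec_def primeideal_def dest: ideal.Icarr)
    then show ?thesis unfolding carr Spec_map_def by auto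
  qed
  have f_image: "?f ((+>) I ` P) = P" if "P \<in> vanishing_set R I" for P
  proof -
    have P: "ideal P R" "I \<subseteq> P" "P \<subseteq> carrier R"
      using that by (auto simp: vanishing_set_def Spec_def primeideal_def dest: ideal.Icarr)
    then show ?thesis
      using I.rcos_eq_in_superideal[OF P(1,2)] unfolding Spec_map_def by blast
  qed
  have f_in: "?f P \<in> vanishing_set R I" if "P \<in> Spec ?Q" for P
  proof -
    have "I \<in> P"
      using that additive_subgroup.zero_closed[of P ?Q]
      by (simp add: Spec_def primeideal_def ideal_def FactRing_def)
    then have "I \<subseteq> ?f P"
      using I.a_rcos_const I.Icarr unfolding Spec_map_def by auto
    then show ?thesis using Spec_map_in_Spec[OF is_cring Q hom that] by (simp add: vanishing_set_def)
  qed
  have image_in: "(+>) I ` P \<in> Spec ?Q" if "P \<in> vanishing_set R I" for P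
    using that primeideal_quotient_image[OF assms(2)] by (simp add: vanishing_set_def Spec_def)
  have top: "topspace (subtopology (zariski R) (vanishing_set R I)) = vanishing_set R I"
    by (auto simp: topspace_zariski vanishing_set_def)
  show ?thesis
  proof (rule bijective_closed_imp_homeomorphic_map)
    show "continuous_map (zariski ?Q) (subtopology (zariski R) (vanishing_set R I)) ?f"
      using continuous_map_Spec_map[OF is_cring Q hom] f_in
      by (auto simp: continuous_map_in_subtopology topspace_zariski)
    show "?f ` topspace (zariski ?Q) = topspace (subtopology (zariski R) (vanishing_set R I))"
      unfolding top topspace_zariski
    proof (intro equalityI subsetI)
      fix P assume "P \<in> vanishing_set R I"
      then show "P \<in> ?f ` Spec ?Q"
        using f_image image_in by (intro image_eqI[of _ _ "(+>) I ` P"]) simp_all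
    qed (use f_in in blast)
    show "inj_on ?f (topspace (zariski ?Q))"
      unfolding topspace_zariski by (metis image_f inj_onI)
    show "closed_map (zariski ?Q) (subtopology (zariski R) (vanishing_set R I)) ?f"
      unfolding closed_map_def
    proof (intro allI impI)
      fix C assume "closedin (zariski ?Q) C"
      then obtain E where E: "E \<subseteq> carrier ?Q" "C = vanishing_set ?Q E"
        unfolding closedin_zariski by blast
      let ?E = "{a \<in> carrier R. I +> a \<in> E}"
      have imE: "(+>) I ` ?E = E" using E(1) unfolding carr by auto
      have iff: "?f P \<in> vanishing_set R ?E \<longleftrightarrow> P \<in> C" if "P \<in> Spec ?Q" for P
        using Spec_map_vanishing_set_iff[OF is_cring Q hom that, of ?E] imE E(2) by auto
      have "?f ` C = vanishing_set R ?E \<inter> vanishing_set R I"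
      proof (intro equalityI subsetI)
        fix P assume "P \<in> ?f ` C"
        then obtain P' where P': "P' \<in> C" "P = ?f P'" by blast
        then have "P' \<in> Spec ?Q" using E(2) by (simp add: vanishing_set_def)
        then show "P \<in> vanishing_set R ?E \<inter> vanishing_set R I" using P' iff f_in by blast
      next
        fix P assume P: "P \<in> vanishing_set R ?E \<inter> vanishing_set R I"
        then have "(+>) I ` P \<in> C" using iff[of "(+>) I ` P"] image_in f_image by auto
        then show "P \<in> ?f ` C" using f_image P by (intro image_eqI[of _ _ "(+>) I ` P"]) simp_all
      qed
      moreover have "closedin (zariski R) (vanishing_set R ?E)"
        unfolding closedin_zariski by (intro exI[of _ ?E]) simp
      ultimately show "closedin (subtopology (zariski R) (vanishing_set R I)) (?f ` C)"
        unfolding closedin_subtopology by blast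
    qed
  qed
qed

lemma connected_Spec_quotient_iff:
  assumes "cring R" "ideal I R"
  shows "connected_space (zariski (R Quot I)) \<longleftrightarrow> connectedin (zariski R) (vanishing_set R I)"
    and "topspace (zariski (R Quot I)) = {} \<longleftrightarrow> vanishing_set R I = {}"
proof -
  let ?Y = "subtopology (zariski R) (vanishing_set R I)"
  have "vanishing_set R I \<subseteq> topspace (zariski R)"
    by (auto simp: topspace_zariski vanishing_set_def)
  moreover have hom: "homeomorphic_map (zariski (R Quot I)) ?Y (Spec_map R ((+>\<^bsub>R\<^esub>) I))"
    by (rule homeomorphic_map_Spec_quotient[OF assms])
  ultimately show "connected_space (zariski (R Quot I)) \<longleftrightarrow> connectedin (zariski R) (vanishing_set R I)"
    using homeomorphic_connected_space[OF homeomorphic_map_imp_homeomorphic_space[OF hom]]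
    by (simp add: connectedin_def)
  show "topspace (zariski (R Quot I)) = {} \<longleftrightarrow> vanishing_set R I = {}"
    using homeomorphic_imp_surjective_map[OF hom] \<open>vanishing_set R I \<subseteq> _\<close> by auto
qed

section \<open>Leading monomials and the lemma of Gauss\<close>

lemma lookup_mult_keys:
  fixes a b :: "'m::monoid_add \<Rightarrow>\<^sub>0 'a::semiring_0"
  shows "Poly_Mapping.lookup (a * b) k =
    (\<Sum>(l, q)\<in>Poly_Mapping.keys a \<times> Poly_Mapping.keys b.
      Poly_Mapping.lookup a l * Poly_Mapping.lookup b q when k = l + q)"
proof -
  have inner: "(\<Sum>q. Poly_Mapping.lookup b q when k = l + q) =
      (\<Sum>q\<in>Poly_Mapping.keys b. Poly_Mapping.lookup b q when k = l + q)" for l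
    by (rule Sum_any.expand_superset) (auto simp: in_keys_iff)
  have "Poly_Mapping.lookup (a * b) k = (\<Sum>l\<in>Poly_Mapping.keys a. Poly_Mapping.lookup a l *
      (\<Sum>q\<in>Poly_Mapping.keys b. Poly_Mapping.lookup b q when k = l + q))"
    unfolding lookup_mult inner
    by (rule Sum_any.expand_superset) (auto simp: in_keys_iff)
  also have "\<dots> = (\<Sum>l\<in>Poly_Mapping.keys a. \<Sum>q\<in>Poly_Mapping.keys b.
      Poly_Mapping.lookup a l * Poly_Mapping.lookup b q when k = l + q)"
    by (simp add: sum_distrib_left mult_when)
  finally show ?thesis by (simp add: sum.cartesian_product)
qed

text \<open>
  Both ordinary leading terms (\<open>c = 0\<close>) and leading terms modulo a prime (\<open>c\<close> prime) are covered
  by calling a coefficient negligible if \<open>c\<close> divides it. Whenever \<open>\<alpha> + \<beta> = l + q\<close> with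
  \<open>(l, q) \<noteq> (\<alpha>, \<beta>)\<close>, one of \<open>l > \<alpha>\<close>, \<open>q > \<beta>\<close> holds, so up to negligible terms only the product
  of the two leading coefficients contributes.
\<close>

lemma dvd_lookup_mult_diff_leading:
  fixes a b :: "'m::{ordered_cancel_comm_monoid_add, linorder} \<Rightarrow>\<^sub>0 'a::comm_ring_1"
  assumes a: "\<not> c dvd Poly_Mapping.lookup a \<alpha>" "\<And>\<mu>. \<alpha> < \<mu> \<Longrightarrow> c dvd Poly_Mapping.lookup a \<mu>"
    and b: "\<not> c dvd Poly_Mapping.lookup b \<beta>" "\<And>\<mu>. \<beta> < \<mu> \<Longrightarrow> c dvd Poly_Mapping.lookup b \<mu>"
  shows "c dvd Poly_Mapping.lookup (a * b) (\<alpha> + \<beta>) - Poly_Mapping.lookup a \<alpha> * Poly_Mapping.lookup b \<beta>"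
proof -
  let ?S = "Poly_Mapping.keys a \<times> Poly_Mapping.keys b"
  let ?t = "\<lambda>(l, q). Poly_Mapping.lookup a l * Poly_Mapping.lookup b q when \<alpha> + \<beta> = l + q"
  have mem: "(\<alpha>, \<beta>) \<in> ?S"
    using a(1) b(1) by (auto simp: in_keys_iff)
  have "c dvd ?t x" if "x \<in> ?S - {(\<alpha>, \<beta>)}" for x
  proof (cases "\<alpha> + \<beta> = fst x + snd x")
    case True
    \<comment> \<open>Otherwise both components are bounded by those of \<open>(\<alpha>, \<beta>)\<close>, and equality of the sums forces
      equality of the pairs.\<close>
    have "\<alpha> < fst x \<or> \<beta> < snd x"
    proof (rule ccontr)
      assume "\<not> (\<alpha> < fst x \<or> \<beta> < snd x)"
      then have le: "fst x \<le> \<alpha>" "snd x \<le> \<beta>" by auto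
      then have "fst x = \<alpha>"
        using add_less_le_mono[of "fst x" \<alpha> "snd x" \<beta>] True by (auto simp: le_less)
      then show False using True that by (cases x) auto
    qed
    then show ?thesis using a(2) b(2) by (auto simp: split_def when_def)
  qed (simp add: split_def)
  then have "c dvd (\<Sum>x\<in>?S - {(\<alpha>, \<beta>)}. ?t x)" by (rule dvd_sum)
  moreover have "Poly_Mapping.lookup (a * b) (\<alpha> + \<beta>) = ?t (\<alpha>, \<beta>) + (\<Sum>x\<in>?S - {(\<alpha>, \<beta>)}. ?t x)"
    unfolding lookup_mult_keys by (rule sum.remove) (use mem in auto)
  ultimately show ?thesis by simp
qed

lemma obtain_leading_monomial:
  fixes a :: "'m::linorder \<Rightarrow>\<^sub>0 'a::comm_ring_1"
  assumes "\<not> (\<forall>\<mu>. c dvd Poly_Mapping.lookup a \<mu>)"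
  obtains \<alpha> where "\<not> c dvd Poly_Mapping.lookup a \<alpha>" "\<And>\<mu>. \<alpha> < \<mu> \<Longrightarrow> c dvd Poly_Mapping.lookup a \<mu>"
proof -
  let ?S = "{\<mu>. \<not> c dvd Poly_Mapping.lookup a \<mu>}"
  have "finite ?S"
    by (rule finite_subset[of _ "Poly_Mapping.keys a"]) (auto simp: in_keys_iff)
  moreover have "?S \<noteq> {}" using assms by blast
  ultimately have "Max ?S \<in> ?S" "\<And>\<mu>. \<mu> \<in> ?S \<Longrightarrow> \<mu> \<le> Max ?S"
    using Max_in Max_ge by blast+
  then show ?thesis using that[of "Max ?S"] not_le by blast
qed

text \<open>
  Gauss's lemma: if \<open>p\<close> divided neither all coefficients of \<open>a\<close> nor all those of \<open>b\<close>, the product of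
  the two leading coefficients modulo \<open>p\<close> would be a coefficient of \<open>a * b\<close> modulo \<open>p\<close>, and
  it is nonzero there because \<open>p\<close> is prime.
\<close>

lemma Gauss_dvd_lookup_mult:
  fixes a b :: "'m::{ordered_cancel_comm_monoid_add, linorder} \<Rightarrow>\<^sub>0 'a::comm_ring_1"
  assumes "prime_elem p" "\<forall>\<mu>. p dvd Poly_Mapping.lookup (a * b) \<mu>"
  shows "(\<forall>\<mu>. p dvd Poly_Mapping.lookup a \<mu>) \<or> (\<forall>\<mu>. p dvd Poly_Mapping.lookup b \<mu>)"
proof (rule ccontr)
  assume "\<not> ?thesis"
  then obtain \<alpha> \<beta> where
      \<alpha>: "\<not> p dvd Poly_Mapping.lookup a \<alpha>" "\<And>\<mu>. \<alpha> < \<mu> \<Longrightarrow> p dvd Poly_Mapping.lookup a \<mu>"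
    and \<beta>: "\<not> p dvd Poly_Mapping.lookup b \<beta>" "\<And>\<mu>. \<beta> < \<mu> \<Longrightarrow> p dvd Poly_Mapping.lookup b \<mu>"
    using obtain_leading_monomial[of p a] obtain_leading_monomial[of p b] by metis
  have "p dvd Poly_Mapping.lookup a \<alpha> * Poly_Mapping.lookup b \<beta>"
    using dvd_diff[OF assms(2)[rule_format] dvd_lookup_mult_diff_leading[of p a \<alpha> b \<beta>],
        of "\<alpha> + \<beta>"] \<alpha> \<beta> by simp
  then show False using assms(1) \<alpha>(1) \<beta>(1) by (simp add: prime_elem_dvd_mult_iff)
qed

section \<open>Polynomials in a given set of variables\<close>

text \<open>
  The polynomials in the variables indexed by \<open>W\<close>. With \<open>W = {1..n}\<close> this is the carrier of
  \<open>mpoly_ring n\<close>; the general form makes it possible to say that one variable does not occur.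
\<close>

definition polys_in :: "nat set \<Rightarrow> ((nat \<Rightarrow>\<^sub>0 nat) \<Rightarrow>\<^sub>0 'a::comm_ring_1) set"
  where "polys_in W = {q. \<forall>m \<in> Poly_Mapping.keys q. Poly_Mapping.keys m \<subseteq> W}"

lemma carrier_mpoly_ring: "carrier (mpoly_ring n) = polys_in {1..n}"
  by (intro Set.set_eqI) (simp only: mpoly_ring_simps polys_in_def mem_Collect_eq)

lemma polys_in_mono: "V \<subseteq> W \<Longrightarrow> polys_in V \<subseteq> polys_in W"
  by (auto simp: polys_in_def)

lemma polys_in_add: "a \<in> polys_in W \<Longrightarrow> b \<in> polys_in W \<Longrightarrow> a + b \<in> polys_in W"
  using keys_add[of a b] by (fastforce simp: polys_in_def)

lemma polys_in_uminus: "a \<in> polys_in W \<Longrightarrow> - a \<in> polys_in W"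
  by (simp add: polys_in_def)

lemma polys_in_mult:
  assumes "a \<in> polys_in W" "b \<in> polys_in W"
  shows "a * b \<in> polys_in W"
  unfolding polys_in_def
proof (intro CollectI ballI)
  fix m assume "m \<in> Poly_Mapping.keys (a * b)"
  then obtain \<alpha> \<beta> where "\<alpha> \<in> Poly_Mapping.keys a" "\<beta> \<in> Poly_Mapping.keys b" "m = \<alpha> + \<beta>"
    using keys_mult[of a b] by blast
  then show "Poly_Mapping.keys m \<subseteq> W"
    using assms keys_add[of \<alpha> \<beta>] by (fastforce simp: polys_in_def)
qed

lemma polys_in_sum: "(\<And>i. i \<in> A \<Longrightarrow> a i \<in> polys_in W) \<Longrightarrow> (\<Sum>i\<in>A. a i) \<in> polys_in W"
  by (induction A rule: infinite_finite_induct) (simp_all add: polys_in_add, simp_all add: polys_in_def)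

lemma polys_in_const: "mpoly_const c \<in> polys_in W"
  by (simp add: polys_in_def mpoly_const_def)

lemma polys_in_var: "i \<in> W \<Longrightarrow> mpoly_var i \<in> polys_in W"
  by (simp add: polys_in_def mpoly_var_def)

lemma mpoly_const_mult: "mpoly_const (a * b) = mpoly_const a * mpoly_const b"
  by (simp add: mpoly_const_def mult_single)

lemma mpoly_const_add: "mpoly_const (a + b) = mpoly_const a + mpoly_const b"
  by (simp add: mpoly_const_def single_add)

lemma mpoly_const_one: "mpoly_const 1 = 1"
  by (simp add: mpoly_const_def)

lemma mpoly_const_eq_0_iff: "mpoly_const a = 0 \<longleftrightarrow> a = 0"
  by (metis mpoly_const_def lookup_single_eq lookup_zero single_zero)

lemma lookup_mpoly_const_mult:
  "Poly_Mapping.lookup (mpoly_const c * q) \<mu> = c * Poly_Mapping.lookup q \<mu>"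
proof -
  have "mpoly_const c * q = Poly_Mapping.map ((*) c) q"
    by (simp add: mpoly_const_def mult_map_scale_conv_mult)
  then show ?thesis by (simp add: map.rep_eq when_def)
qed

text \<open>
  A coefficientwise quotient. It has to send \<open>0\<close> to \<open>0\<close>, so that it is finitely supported and
  introduces no new monomials; this is why \<open>0\<close> is treated apart in the choice below.
\<close>

lemma mpoly_const_dvdE:
  assumes "q \<in> polys_in W" "\<And>\<mu>. c dvd Poly_Mapping.lookup q \<mu>"
  obtains r where "r \<in> polys_in W" "q = mpoly_const c * r"
proof -
  define g where "g x = (if x = 0 then 0 else SOME e. x = c * e)" for x :: 'a
  have g: "c * g x = x" if "c dvd x" for x
    using someI_ex[of "\<lambda>e. x = c * e"] that by (auto simp: g_def dvd_def)
  let ?r = "Poly_Mapping.map g q"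
  have l: "Poly_Mapping.lookup ?r \<mu> = g (Poly_Mapping.lookup q \<mu>)" for \<mu>
    by (simp add: map.rep_eq when_def g_def)
  show ?thesis
  proof (rule that)
    show "?r \<in> polys_in W"
      using assms(1) by (auto simp: polys_in_def in_keys_iff l g_def)
    show "q = mpoly_const c * ?r"
      by (rule poly_mapping_eqI) (simp add: lookup_mpoly_const_mult l g assms(2))
  qed
qed

lemma single_one_eq_iff:
  "Poly_Mapping.single i (1::nat) = Poly_Mapping.single j 1 \<longleftrightarrow> i = j"
  by (metis lookup_single_eq lookup_single_not_eq zero_neq_one)

lemma single_one_neq_0: "Poly_Mapping.single i (1::nat) \<noteq> 0"
  by (metis lookup_single_eq lookup_zero zero_neq_one)

lemma lookup_forcing_poly:
  "Poly_Mapping.lookup (forcing_poly n f g) \<mu> =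
    (\<Sum>i = 1..n. f i when \<mu> = Poly_Mapping.single i 1) + (g when \<mu> = 0)"
proof -
  have flip: "Poly_Mapping.lookup (Poly_Mapping.single k v) \<mu> = (v when \<mu> = k)" for k and v :: 'a
    by (auto simp: lookup_single when_def)
  show ?thesis
    by (simp add: forcing_poly_def mpoly_const_def mpoly_var_def mult_single lookup_add lookup_sum flip)
qed

lemma lookup_forcing_poly_var:
  assumes "j \<in> {1..n}"
  shows "Poly_Mapping.lookup (forcing_poly n f g) (Poly_Mapping.single j 1) = f j"
  using assms unfolding lookup_forcing_poly single_one_eq_iff by (simp add: when_def single_one_neq_0 del: One_nat_def)

lemma lookup_forcing_poly_0: "Poly_Mapping.lookup (forcing_poly n f g) 0 = g"
  unfolding lookup_forcing_poly by (simp add: single_one_neq_0[symmetric] del: One_nat_def)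

lemma forcing_poly_scale:
  assumes "\<forall>i\<in>{1..n}. f i = d * f' i" "g = d * g'"
  shows "forcing_poly n f g = mpoly_const d * forcing_poly n f' g'"
  using assms by (simp add: forcing_poly_def mpoly_const_mult distrib_left sum_distrib_left mult.assoc)

section \<open>Primitive forcing polynomials are prime\<close>

text \<open>
  The order on monomials is lexicographic with the variable of smallest index as the largest one.
\<close>

lemma single_one_less_iff:
  fixes i j :: nat
  shows "Poly_Mapping.single i (1::nat) < Poly_Mapping.single j 1 \<longleftrightarrow> j < i"
proof -
  have "Poly_Mapping.single i (1::nat) < Poly_Mapping.single j 1" if "j < i" for i j :: nat
    unfolding less_poly_mapping.rep_eq less_fun_def
    by (rule exI[of _ j]) (use that in \<open>auto simp: lookup_single when_def\<close>)
  then show ?thesis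
    by (metis less_asym linorder_less_linear)
qed

lemma zero_less_single_one: "0 < Poly_Mapping.single (i::nat) (1::nat)"
  unfolding less_poly_mapping.rep_eq less_fun_def
  by (rule exI[of _ i]) (auto simp: lookup_single when_def)

lemma obtain_least_nonzero:
  fixes f :: "nat \<Rightarrow> 'a::zero" and n :: nat
  assumes "\<exists>i\<in>{1..n}. f i \<noteq> 0"
  obtains j where "j \<in> {1..n}" "f j \<noteq> 0" "\<forall>i\<in>{1..<j}. f i = 0"
proof -
  define j where "j = (LEAST i. i \<in> {1..n} \<and> f i \<noteq> 0)"
  have j: "j \<in> {1..n}" "f j \<noteq> 0"
    using LeastI_ex[of "\<lambda>i. i \<in> {1..n} \<and> f i \<noteq> 0"] assms unfolding j_def by blast+
  have least: "\<forall>i\<in>{1..<j}. f i = 0"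
  proof
    fix i assume i: "i \<in> {1..<j}"
    then have "\<not> (i \<in> {1..n} \<and> f i \<noteq> 0)"
      unfolding j_def by (intro not_less_Least) simp
    then show "f i = 0" using i j(1) by auto
  qed
  show ?thesis using that[OF j least] .
qed

text \<open>
  For the lexicographic order, \<open>T\<^sub>j\<close> is the leading monomial of the linear polynomial if \<open>j\<close> is the
  least index with \<open>f j \<noteq> 0\<close>. Hence \<open>T\<^sub>j\<close> divides the leading monomial of every nonzero multiple.
\<close>

lemma forcing_poly_mult_not_in_polys_in:
  fixes f :: "nat \<Rightarrow> 'a::idom"
  assumes j: "j \<in> {1..n}" "f j \<noteq> 0" and least: "\<forall>i\<in>{1..<j}. f i = 0"
    and "u \<noteq> 0" and "j \<notin> W"
  shows "forcing_poly n f g * u \<notin> polys_in W"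
proof
  let ?h = "forcing_poly n f g" and ?\<alpha> = "Poly_Mapping.single j (1::nat)"
  assume W: "?h * u \<in> polys_in W"
  have "\<not> (\<forall>\<mu>. 0 dvd Poly_Mapping.lookup u \<mu>)"
    using \<open>u \<noteq> 0\<close> poly_mapping_eqI[of u 0] by auto
  then obtain \<beta> where \<beta>: "\<not> 0 dvd Poly_Mapping.lookup u \<beta>"
      "\<And>\<mu>. \<beta> < \<mu> \<Longrightarrow> 0 dvd Poly_Mapping.lookup u \<mu>"
    using obtain_leading_monomial by blast
  have "Poly_Mapping.lookup ?h \<mu> = 0" if "?\<alpha> < \<mu>" for \<mu>
  proof -
    have "(f i when \<mu> = Poly_Mapping.single i 1) = 0" if "i \<in> {1..n}" for i
      using \<open>?\<alpha> < \<mu>\<close> that least by (cases "i < j") (auto simp: when_def single_one_less_iff simp del: One_nat_def)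
    moreover have "\<mu> \<noteq> 0"
      using that zero_less_single_one[of j] by auto
    ultimately show ?thesis unfolding lookup_forcing_poly by (simp add: sum.neutral)
  qed
  then have "0 dvd Poly_Mapping.lookup (?h * u) (?\<alpha> + \<beta>) - Poly_Mapping.lookup ?h ?\<alpha> * Poly_Mapping.lookup u \<beta>"
    using \<beta> j by (intro dvd_lookup_mult_diff_leading) (simp_all add: lookup_forcing_poly_var del: One_nat_def)
  then have "Poly_Mapping.lookup (?h * u) (?\<alpha> + \<beta>) \<noteq> 0"
    using \<beta>(1) j lookup_forcing_poly_var[OF j(1), of f g] by simp
  then have "Poly_Mapping.keys (?\<alpha> + \<beta>) \<subseteq> W"
    using W by (auto simp: polys_in_def in_keys_iff)
  moreover have "j \<in> Poly_Mapping.keys (?\<alpha> + \<beta>)"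
    by (simp add: in_keys_iff lookup_add)
  ultimately show False using \<open>j \<notin> W\<close> by blast
qed

lemma sum_single_keys:
  fixes q :: "'m \<Rightarrow>\<^sub>0 'a::comm_monoid_add"
  shows "q = (\<Sum>\<mu>\<in>Poly_Mapping.keys q. Poly_Mapping.single \<mu> (Poly_Mapping.lookup q \<mu>))"
  by (rule poly_mapping_eqI) (simp add: lookup_sum lookup_single when_def in_keys_iff)

text \<open>
  Division by \<open>c T\<^sub>j + g\<close> with respect to \<open>T\<^sub>j\<close>, after clearing denominators. The polynomials for
  which it is possible are closed under sums; they contain those without \<open>T\<^sub>j\<close>, and they are stable
  under multiplication by \<open>T\<^sub>j\<close> because \<open>c T\<^sub>j\<close> may be replaced by \<open>-g\<close> modulo \<open>h\<close>.
\<close>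

lemma pseudo_division:
  fixes c :: "'a::comm_ring_1"
  assumes h: "h = mpoly_const c * mpoly_var j + g" "g \<in> polys_in (W - {j})" and "j \<in> W"
    and q: "q \<in> polys_in W"
  shows "\<exists>N. \<exists>u\<in>polys_in W. \<exists>r\<in>polys_in (W - {j}). mpoly_const (c ^ N) * q = h * u + r"
proof -
  let ?P = "\<lambda>q. \<exists>N. \<exists>u\<in>polys_in W. \<exists>r\<in>polys_in (W - {j}). mpoly_const (c ^ N) * q = h * u + r"
  have mono: "a \<in> polys_in W" if "a \<in> polys_in (W - {j})" for a :: "(nat \<Rightarrow>\<^sub>0 nat) \<Rightarrow>\<^sub>0 'a"
    using that polys_in_mono[of "W - {j}" W] by blast
  have add: "?P (a + b)" if a: "?P a" and b: "?P b" for a b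
  proof -
    obtain N u r where u: "u \<in> polys_in W" "r \<in> polys_in (W - {j})" "mpoly_const (c ^ N) * a = h * u + r"
      using a by blast
    obtain M v s where v: "v \<in> polys_in W" "s \<in> polys_in (W - {j})" "mpoly_const (c ^ M) * b = h * v + s"
      using b by blast
    have "mpoly_const (c ^ (N + M)) * (a + b)
        = mpoly_const (c ^ M) * (mpoly_const (c ^ N) * a) + mpoly_const (c ^ N) * (mpoly_const (c ^ M) * b)"
      by (simp add: power_add mpoly_const_mult algebra_simps)
    also have "\<dots> = h * (mpoly_const (c ^ M) * u + mpoly_const (c ^ N) * v) + (mpoly_const (c ^ M) * r + mpoly_const (c ^ N) * s)"
      unfolding u(3) v(3) by (simp add: algebra_simps)
    finally show ?thesis
      using u v by (blast intro: polys_in_add polys_in_mult polys_in_const)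
  qed
  have var: "?P (mpoly_var j * a)" if a: "?P a" for a
  proof -
    obtain N u r where u: "u \<in> polys_in W" "r \<in> polys_in (W - {j})" "mpoly_const (c ^ N) * a = h * u + r"
      using a by blast
    have cT: "mpoly_const c * mpoly_var j = h - g" using h(1) by simp
    \<comment> \<open>One more factor \<open>c\<close> pays for replacing \<open>T\<^sub>j\<close> by \<open>-g\<close>.\<close>
    have "mpoly_const (c ^ Suc N) * (mpoly_var j * a)
        = (mpoly_const c * mpoly_var j) * (mpoly_const (c ^ N) * a)"
      by (simp add: mpoly_const_mult algebra_simps)
    also have "\<dots> = (mpoly_const c * mpoly_var j) * h * u + (mpoly_const c * mpoly_var j) * r"
      unfolding u(3) by (simp add: algebra_simps)
    also have "\<dots> = h * (mpoly_const c * mpoly_var j * u + r) + - (g * r)"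
      unfolding cT by (simp add: algebra_simps)
    finally have "mpoly_const (c ^ Suc N) * (mpoly_var j * a) = h * (mpoly_const c * mpoly_var j * u + r) + - (g * r)" .
    moreover have "mpoly_const c * mpoly_var j * u + r \<in> polys_in W"
      using u mono \<open>j \<in> W\<close> by (blast intro: polys_in_add polys_in_mult polys_in_const polys_in_var)
    moreover have "- (g * r) \<in> polys_in (W - {j})"
      using u h(2) by (blast intro: polys_in_uminus polys_in_mult)
    ultimately show ?thesis by blast
  qed
  have monom: "?P (Poly_Mapping.single \<mu> a)" if "Poly_Mapping.keys \<mu> \<subseteq> W" for \<mu> a
    using that
  proof (induction "Poly_Mapping.lookup \<mu> j" arbitrary: \<mu>)
    case 0
    then have "Poly_Mapping.single \<mu> a \<in> polys_in (W - {j})"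
      by (auto simp: polys_in_def in_keys_iff)
    moreover have "mpoly_const (c ^ 0) * Poly_Mapping.single \<mu> a = h * 0 + Poly_Mapping.single \<mu> a"
      by (simp add: mpoly_const_one)
    moreover have "(0 :: (nat \<Rightarrow>\<^sub>0 nat) \<Rightarrow>\<^sub>0 'a) \<in> polys_in W" by (simp add: polys_in_def)
    ultimately show ?case by blast
  next
    case (Suc e)
    let ?\<nu> = "\<mu> - Poly_Mapping.single j 1"
    have \<mu>: "\<mu> = Poly_Mapping.single j 1 + ?\<nu>"
      using Suc.hyps(2) by (intro poly_mapping_eqI) (auto simp: lookup_add lookup_minus lookup_single when_def)
    have "e = Poly_Mapping.lookup ?\<nu> j" using Suc.hyps(2) by (simp add: lookup_minus)
    moreover have "Poly_Mapping.keys ?\<nu> \<subseteq> W"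
      using Suc.prems by (auto simp: in_keys_iff lookup_minus)
    ultimately have "?P (Poly_Mapping.single ?\<nu> a)" by (rule Suc.hyps(1))
    then have "?P (mpoly_var j * Poly_Mapping.single ?\<nu> a)" by (rule var)
    then show ?case by (subst \<mu>) (simp add: mpoly_var_def mult_single)
  qed
  have "?P (\<Sum>\<mu>\<in>A. Poly_Mapping.single \<mu> (Poly_Mapping.lookup q \<mu>))" if "finite A" "A \<subseteq> Poly_Mapping.keys q" for A
    using that
  proof (induction A rule: finite_induct)
    case empty
    have "(0 :: (nat \<Rightarrow>\<^sub>0 nat) \<Rightarrow>\<^sub>0 'a) \<in> polys_in V" for V by (simp add: polys_in_def)
    moreover have "mpoly_const (c ^ 0) * 0 = h * 0 + 0" by simp
    ultimately have "?P 0" by blast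
    then show ?case by simp
  next
    case (insert \<mu> A)
    have "Poly_Mapping.keys \<mu> \<subseteq> W"
      using q insert.prems by (auto simp: polys_in_def)
    then show ?case
      using add[OF monom insert.IH] insert.hyps insert.prems by simp
  qed
  from this[OF finite_keys order_refl] show ?thesis by (subst sum_single_keys)
qed

text \<open>
  Constants can be cancelled one prime factor at a time: a prime \<open>p\<close> that divides \<open>h * u\<close> divides
  \<open>u\<close> by Gauss's lemma, since it does not divide the primitive polynomial \<open>h\<close>.
\<close>

lemma primitive_dvd_cancel_const:
  fixes h :: "(nat \<Rightarrow>\<^sub>0 nat) \<Rightarrow>\<^sub>0 'a::{factorial_semiring, idom}"
  assumes primitive: "\<And>p. prime_elem p \<Longrightarrow> \<exists>\<mu>. \<not> p dvd Poly_Mapping.lookup h \<mu>"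
    and "c \<noteq> 0" "u \<in> polys_in W" "mpoly_const c * a = h * u"
  shows "\<exists>v\<in>polys_in W. a = h * v"
  using assms(2-4)
proof (induction c arbitrary: u rule: prime_divisors_induct)
  case zero
  then show ?case by simp
next
  case (unit c)
  then obtain e where e: "1 = e * c" by (metis dvdE mult.commute)
  have "a = mpoly_const e * (mpoly_const c * a)"
    by (simp add: e[symmetric] mpoly_const_one flip: mult.assoc mpoly_const_mult)
  also have "\<dots> = h * (mpoly_const e * u)" unfolding unit.prems(3) by (simp add: mult.left_commute)
  finally show ?case using unit.prems(2) polys_in_const polys_in_mult by blast
next
  case (factor p c)
  then have p: "prime_elem p" by auto
  have "Poly_Mapping.lookup (h * u) \<mu> = p * (c * Poly_Mapping.lookup a \<mu>)" for \<mu>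
    unfolding factor.prems(3)[symmetric] lookup_mpoly_const_mult by (simp add: mult.assoc)
  then have "\<forall>\<mu>. p dvd Poly_Mapping.lookup u \<mu>"
    using Gauss_dvd_lookup_mult[OF p, of h u] primitive[OF p] by auto
  then obtain v where v: "v \<in> polys_in W" "u = mpoly_const p * v"
    using mpoly_const_dvdE[OF factor.prems(2)] by metis
  have "mpoly_const p * (mpoly_const c * a) = mpoly_const p * (h * v)"
    using factor.prems(3) v(2) by (simp add: mpoly_const_mult algebra_simps)
  moreover have "mpoly_const p \<noteq> 0" using factor.prems(1) by (simp add: mpoly_const_eq_0_iff)
  ultimately have "mpoly_const c * a = h * v" by simp
  then show ?case using factor.IH factor.prems(1) v(1) by simp
qed

text \<open>
  Over the fraction field, \<open>h\<close> could be solved for the variable \<open>T\<^sub>j\<close>, and the quotient by \<open>h\<close> would be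
  a polynomial ring in the other variables, hence a domain. The proof does this without denominators:
  the remainders \<open>r\<close>, \<open>s\<close> of \<open>a\<close>, \<open>b\<close> on pseudo-division do not involve \<open>T\<^sub>j\<close>, and \<open>h\<close> divides
  \<open>r * s\<close>. A nonzero multiple of \<open>h\<close> involves \<open>T\<^sub>j\<close>, so \<open>r = 0\<close> or \<open>s = 0\<close>. Primitivity then
  removes the power of \<open>f j\<close>.
\<close>

lemma primitive_forcing_poly_prime:
  fixes f :: "nat \<Rightarrow> 'a::{factorial_semiring, idom}" and g :: 'a and n :: nat
  defines "h \<equiv> forcing_poly n f g"
  assumes nonzero: "\<exists>i\<in>{1..n}. f i \<noteq> 0"
    and primitive: "\<And>p. prime_elem p \<Longrightarrow> \<exists>x\<in>insert g (f ` {1..n}). \<not> p dvd x"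
    and ab: "a \<in> polys_in {1..n}" "b \<in> polys_in {1..n}" "u \<in> polys_in {1..n}" "a * b = h * u"
  shows "(\<exists>v\<in>polys_in {1..n}. a = h * v) \<or> (\<exists>v\<in>polys_in {1..n}. b = h * v)"
proof -
  let ?W = "{1..n}"
  obtain j where j: "j \<in> ?W" "f j \<noteq> 0" and least: "\<forall>i\<in>{1..<j}. f i = 0"
    using obtain_least_nonzero[OF nonzero] .
  let ?g = "(\<Sum>i\<in>?W - {j}. mpoly_const (f i) * mpoly_var i) + mpoly_const g"
  have h: "h = mpoly_const (f j) * mpoly_var j + ?g"
    unfolding h_def forcing_poly_def using j(1) by (simp add: sum.remove add.assoc)
  have g: "?g \<in> polys_in (?W - {j})"
    by (intro polys_in_add polys_in_sum polys_in_mult polys_in_const polys_in_var)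
  obtain N v r where a: "v \<in> polys_in ?W" "r \<in> polys_in (?W - {j})" "mpoly_const (f j ^ N) * a = h * v + r"
    using pseudo_division[OF h g j(1) ab(1)] by blast
  obtain M w s where b: "w \<in> polys_in ?W" "s \<in> polys_in (?W - {j})" "mpoly_const (f j ^ M) * b = h * w + s"
    using pseudo_division[OF h g j(1) ab(2)] by blast
  have "r * s = (mpoly_const (f j ^ N) * a - h * v) * (mpoly_const (f j ^ M) * b - h * w)"
    using a(3) b(3) by simp
  also have "\<dots> = mpoly_const (f j ^ N) * mpoly_const (f j ^ M) * (a * b)
      - h * (v * (mpoly_const (f j ^ M) * b - h * w) + mpoly_const (f j ^ N) * a * w)"
    by (simp add: algebra_simps)
  also have "\<dots> = h * (mpoly_const (f j ^ N) * mpoly_const (f j ^ M) * u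
      - (v * (mpoly_const (f j ^ M) * b - h * w) + mpoly_const (f j ^ N) * a * w))"
    unfolding ab(4) by (simp add: algebra_simps)
  finally obtain z where z: "r * s = h * z" by blast
  moreover have "r * s \<in> polys_in (?W - {j})" using a b by (intro polys_in_mult)
  ultimately have "z = 0"
    using forcing_poly_mult_not_in_polys_in[OF j least, of z "?W - {j}" g] unfolding h_def by auto
  then have "r = 0 \<or> s = 0" using z by simp
  moreover have "\<exists>\<mu>. \<not> p dvd Poly_Mapping.lookup h \<mu>" if "prime_elem p" for p
    using primitive[OF that] lookup_forcing_poly_var[of _ n f g] lookup_forcing_poly_0[of n f g]
    unfolding h_def by (metis imageE insertE)
  note cancel = primitive_dvd_cancel_const[OF this]
  ultimately show ?thesis
    using a(1,3) b(1,3) cancel[of "f j ^ N" v ?W a] cancel[of "f j ^ M" w ?W b] j(2) by auto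
qed

section \<open>Prime ideals of the polynomial ring\<close>

lemma vanishing_set_cgenideal:
  assumes "cring R" "a \<in> carrier R"
  shows "vanishing_set R (PIdl\<^bsub>R\<^esub> a) = vanishing_set R {a}"
  using vanishing_set_genideal[OF assms(1), of "{a}"] cring.cgenideal_eq_genideal[OF assms] assms(2)
  by simp

lemma primeideal_PIdl_mpoly_ringI:
  assumes h: "h \<in> polys_in {1..n}"
    and proper: "\<And>v. v \<in> polys_in {1..n} \<Longrightarrow> h * v \<noteq> 1"
    and prime: "\<And>a b u. \<lbrakk>a \<in> polys_in {1..n}; b \<in> polys_in {1..n}; u \<in> polys_in {1..n}; a * b = h * u\<rbrakk>
      \<Longrightarrow> (\<exists>v\<in>polys_in {1..n}. a = h * v) \<or> (\<exists>v\<in>polys_in {1..n}. b = h * v)"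
  shows "primeideal (PIdl\<^bsub>mpoly_ring n\<^esub> h) (mpoly_ring n)"
proof (rule primeidealI)
  let ?B = "mpoly_ring n :: ((nat \<Rightarrow>\<^sub>0 nat) \<Rightarrow>\<^sub>0 'a) ring"
  interpret cring ?B by (rule cring_mpoly_ring)
  have mem: "a \<in> PIdl\<^bsub>?B\<^esub> h \<longleftrightarrow> (\<exists>v\<in>polys_in {1..n}. a = h * v)" for a
    unfolding cgenideal_def carrier_mpoly_ring mpoly_ring_simps(1) by (auto simp: mult.commute)
  show "ideal (PIdl\<^bsub>?B\<^esub> h) ?B"
    by (rule cgenideal_ideal) (simp only: carrier_mpoly_ring h)
  show "cring ?B" by (rule is_cring)
  show "carrier ?B \<noteq> PIdl\<^bsub>?B\<^esub> h"
    using one_closed proper mem[of 1] unfolding mpoly_ring_simps(3) by metis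
  fix a b assume "a \<in> carrier ?B" "b \<in> carrier ?B" "a \<otimes>\<^bsub>?B\<^esub> b \<in> PIdl\<^bsub>?B\<^esub> h"
  then show "a \<in> PIdl\<^bsub>?B\<^esub> h \<or> b \<in> PIdl\<^bsub>?B\<^esub> h"
    unfolding mem carrier_mpoly_ring mpoly_ring_simps(1) using prime by blast
qed

lemma primeideal_PIdl_mpoly_const:
  fixes p :: "'a::idom"
  assumes p: "prime_elem p"
  shows "primeideal (PIdl\<^bsub>mpoly_ring n\<^esub> (mpoly_const p)) (mpoly_ring n)"
proof (rule primeideal_PIdl_mpoly_ringI[OF polys_in_const])
  fix v :: "(nat \<Rightarrow>\<^sub>0 nat) \<Rightarrow>\<^sub>0 'a"
  have "p * Poly_Mapping.lookup v 0 \<noteq> 1" using p by (metis dvdI prime_elem_not_unit)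
  then show "mpoly_const p * v \<noteq> 1"
    by (metis lookup_mpoly_const_mult lookup_one_zero)
next
  fix a b u :: "(nat \<Rightarrow>\<^sub>0 nat) \<Rightarrow>\<^sub>0 'a"
  assume ab: "a \<in> polys_in {1..n}" "b \<in> polys_in {1..n}" "a * b = mpoly_const p * u"
  have "\<forall>\<mu>. p dvd Poly_Mapping.lookup (a * b) \<mu>"
    unfolding ab(3) lookup_mpoly_const_mult by simp
  then show "(\<exists>v\<in>polys_in {1..n}. a = mpoly_const p * v) \<or> (\<exists>v\<in>polys_in {1..n}. b = mpoly_const p * v)"
    using Gauss_dvd_lookup_mult[OF p] mpoly_const_dvdE[OF ab(1), of p] mpoly_const_dvdE[OF ab(2), of p]
    by metis
qed

lemma primeideal_PIdl_primitive_forcing_poly: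
  fixes f :: "nat \<Rightarrow> 'a::{factorial_semiring, idom}"
  assumes nonzero: "\<exists>i\<in>{1..n}. f i \<noteq> 0"
    and primitive: "\<And>p. prime_elem p \<Longrightarrow> \<exists>x\<in>insert g (f ` {1..n}). \<not> p dvd x"
  shows "primeideal (PIdl\<^bsub>mpoly_ring n\<^esub> (forcing_poly n f g)) (mpoly_ring n)"
proof (rule primeideal_PIdl_mpoly_ringI)
  show "forcing_poly n f g \<in> polys_in {1..n}"
    using forcing_poly_in_carrier by (simp only: carrier_mpoly_ring)
  fix v :: "(nat \<Rightarrow>\<^sub>0 nat) \<Rightarrow>\<^sub>0 'a"
  obtain j where j: "j \<in> {1..n}" "f j \<noteq> 0" "\<forall>i\<in>{1..<j}. f i = 0"
    using obtain_least_nonzero[OF nonzero] .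
  have "1 \<in> (polys_in {} :: ((nat \<Rightarrow>\<^sub>0 nat) \<Rightarrow>\<^sub>0 'a) set)" by (simp add: polys_in_def)
  then show "forcing_poly n f g * v \<noteq> 1"
    using forcing_poly_mult_not_in_polys_in[OF j, of v "{}" g] by (cases "v = 0") auto
qed (rule primitive_forcing_poly_prime[OF nonzero primitive])

section \<open>Projection from affine space and its zero section\<close>

abbreviation (input) coeff_ring :: "'a::comm_ring_1 ring"
  where "coeff_ring \<equiv> ring_of_type_algebra"

lemma coeff_ring_simps:
  "x \<otimes>\<^bsub>coeff_ring\<^esub> y = x * y" "x \<oplus>\<^bsub>coeff_ring\<^esub> y = x + y"
  "\<one>\<^bsub>coeff_ring\<^esub> = 1" "carrier coeff_ring = UNIV"
  by (simp_all add: ring_of_type_algebra_def)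

lemma mpoly_const_ring_hom: "mpoly_const \<in> ring_hom coeff_ring (mpoly_ring n)"
  by (rule ring_hom_memI)
    (simp_all only: mpoly_const_in_carrier coeff_ring_simps mpoly_ring_simps(1-4)
      mpoly_const_mult mpoly_const_add mpoly_const_one)

lemma lookup_mult_0:
  fixes a b :: "(nat \<Rightarrow>\<^sub>0 nat) \<Rightarrow>\<^sub>0 'a::comm_ring_1"
  shows "Poly_Mapping.lookup (a * b) 0 = Poly_Mapping.lookup a 0 * Poly_Mapping.lookup b 0"
proof -
  have eq: "0 = l + q \<longleftrightarrow> l = 0 \<and> q = 0" for l q :: "nat \<Rightarrow>\<^sub>0 nat"
    by (auto simp: poly_mapping_eq_iff fun_eq_iff lookup_add)
  have "Poly_Mapping.lookup (a * b) 0 = (\<Sum>x\<in>Poly_Mapping.keys a \<times> Poly_Mapping.keys b.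
      if x = (0, 0) then Poly_Mapping.lookup a 0 * Poly_Mapping.lookup b 0 else 0)"
    unfolding lookup_mult_keys by (intro sum.cong refl) (auto simp: when_def eq split: if_splits)
  then show ?thesis by (auto simp: in_keys_iff)
qed

text \<open>
  Evaluation at the origin. The map it induces from \<open>Spec R\<close> to \<open>Spec B\<close> is the zero section.
\<close>

lemma lookup_0_ring_hom:
  "(\<lambda>q. Poly_Mapping.lookup q 0) \<in> ring_hom (mpoly_ring n) (coeff_ring :: 'a::comm_ring_1 ring)"
  by (rule ring_hom_memI)
    (simp_all add: coeff_ring_simps mpoly_ring_simps(1-4) lookup_mult_0 lookup_add)

lemma Union_insert_Un: "\<Union>(insert A ((\<lambda>j. A \<union> D j) ` J)) = A \<union> (\<Union>j\<in>J. D j)"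
  by blast

text \<open>
  The sets in the conclusion are the preimages in affine space of the \<open>V(p\<^sub>j) \<subseteq> Spec R\<close>. Each of them is
  irreducible, because \<open>p\<^sub>j\<close> stays prime in \<open>B\<close>, and meets the image of \<open>C = \<Union> V(p\<^sub>j)\<close> under the zero
  section. This image is connected, so it ties the preimages together.
\<close>

lemma connectedin_preimage_union_vanishing_sets:
  fixes p :: "nat \<Rightarrow> 'a::idom" and n :: nat
  defines "B \<equiv> (mpoly_ring n :: ((nat \<Rightarrow>\<^sub>0 nat) \<Rightarrow>\<^sub>0 'a) ring)"
  assumes prime: "\<And>j. j \<in> J \<Longrightarrow> prime_elem (p j)"
    and conn: "connectedin (zariski coeff_ring) (\<Union>j\<in>J. vanishing_set coeff_ring {p j})"
    and ne: "(\<Union>j\<in>J. vanishing_set coeff_ring {p j}) \<noteq> {}"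
  shows "connectedin (zariski B) (\<Union>j\<in>J. vanishing_set B {mpoly_const (p j)})"
proof -
  let ?R = "coeff_ring :: 'a ring" and ?\<epsilon> = "\<lambda>q :: (nat \<Rightarrow>\<^sub>0 nat) \<Rightarrow>\<^sub>0 'a. Poly_Mapping.lookup q 0"
  have R: "cring ?R" by (rule cring_from_type_algebra)
  have B: "cring B" unfolding B_def by (rule cring_mpoly_ring)
  have \<epsilon>: "?\<epsilon> \<in> ring_hom B ?R" unfolding B_def by (rule lookup_0_ring_hom)
  have \<kappa>: "mpoly_const \<in> ring_hom ?R B" unfolding B_def by (rule mpoly_const_ring_hom)
  have const: "mpoly_const c \<in> carrier B" for c unfolding B_def by (rule mpoly_const_in_carrier)
  let ?s = "Spec_map B ?\<epsilon>" and ?C = "\<Union>j\<in>J. vanishing_set ?R {p j}"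
  let ?V = "\<lambda>j. vanishing_set B {mpoly_const (p j)}"
  have s: "?s P \<in> ?V j \<longleftrightarrow> P \<in> vanishing_set ?R {p j}" if "P \<in> Spec ?R" for P j
    using Spec_map_vanishing_set_iff[OF B R \<epsilon> that, of "{mpoly_const (p j)}"] const
    by (simp add: mpoly_const_def)
  have sC: "connectedin (zariski B) (?s ` ?C)"
    using continuous_map_Spec_map[OF B R \<epsilon>] conn by (rule connectedin_continuous_map_image)
  have "connectedin (zariski B) (?s ` ?C \<union> ?V j)" if j: "j \<in> J" for j
  proof (rule connectedin_Un[OF sC])
    \<comment> \<open>The common point: the zero section at the contraction of the prime ideal \<open>p\<^sub>j B\<close>.\<close>
    let ?Q = "PIdl\<^bsub>B\<^esub> (mpoly_const (p j))"
    have Q: "primeideal ?Q B"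
      unfolding B_def by (rule primeideal_PIdl_mpoly_const[OF prime[OF j]])
    have V: "?V j = vanishing_set B ?Q"
      by (rule vanishing_set_cgenideal[OF B const, symmetric])
    show "connectedin (zariski B) (?V j)"
      unfolding V by (rule connectedin_vanishing_set_primeideal[OF Q])
    have "?Q \<in> ?V j" unfolding V using Q by (simp add: vanishing_set_def Spec_def)
    then have "Spec_map ?R mpoly_const ?Q \<in> vanishing_set ?R {p j}"
      using Spec_map_vanishing_set_iff[OF R B \<kappa>, of ?Q "{p j}"]
      by (simp add: coeff_ring_simps vanishing_set_def)
    moreover from this have "?s (Spec_map ?R mpoly_const ?Q) \<in> ?V j"
      using s by (simp add: vanishing_set_def)
    ultimately show "?s ` ?C \<inter> ?V j \<noteq> {}" using j by blast
  qed
  then have "connectedin (zariski B) (\<Union>(insert (?s ` ?C) ((\<lambda>j. ?s ` ?C \<union> ?V j) ` J)))"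
    using sC ne by (intro connectedin_Union) auto
  also have "\<Union>(insert (?s ` ?C) ((\<lambda>j. ?s ` ?C \<union> ?V j) ` J)) = ?s ` ?C \<union> (\<Union>j\<in>J. ?V j)"
    by (rule Union_insert_Un)
  also have "\<dots> = (\<Union>j\<in>J. ?V j)"
    by (rule Un_absorb1) (use s in \<open>auto simp: vanishing_set_def\<close>)
  finally show ?thesis .
qed

section \<open>Connectedness of the forcing algebra\<close>

theorem corollary4p3:
  fixes R :: "'a::{factorial_semiring, idom} ring"
    and f f' :: "nat \<Rightarrow> 'a" and f\<^sub>0 f\<^sub>0' d :: 'a
    and p :: "nat \<Rightarrow> 'a" and n k :: nat
    and I :: "'i set" and J :: "'i \<Rightarrow> nat set"
  defines "R \<equiv> ring_of_type_algebra"
    and "B \<equiv> (mpoly_ring n :: ((nat \<Rightarrow>\<^sub>0 nat) \<Rightarrow>\<^sub>0 'a) ring)"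
    and "h \<equiv> forcing_poly n f f\<^sub>0"
    and "h' \<equiv> forcing_poly n f' f\<^sub>0'"
  assumes nonzero: "\<exists>i \<in> {1..n}. f i \<noteq> 0"
    and common_divisor: "\<forall>a \<in> insert f\<^sub>0 (f ` {1..n}). d dvd a"
    and greatest: "\<forall>c. (\<forall>a \<in> insert f\<^sub>0 (f ` {1..n}). c dvd a) \<longrightarrow> c dvd d"
    and f': "\<forall>i \<in> {1..n}. f i = d * f' i"
    and f\<^sub>0': "f\<^sub>0 = d * f\<^sub>0'"
    and primes: "\<forall>j \<in> {1..k}. prime_elem (p j)"
    and factorization: "d = (\<Prod>j = 1..k. p j)"
    and partition: "disjoint_family_on J I" "(\<Union>i \<in> I. J i) = {1..k}"
    and components:
      "connected_components_of (subtopology (zariski R) (vanishing_set R {d})) =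
        (\<lambda>i. \<Union>j \<in> J i. vanishing_set R {p j}) ` I"
  shows "connected_space (zariski (B Quot (PIdl\<^bsub>B\<^esub> h))) \<and>
      topspace (zariski (B Quot (PIdl\<^bsub>B\<^esub> h))) \<noteq> {} \<longleftrightarrow>
    (\<forall>i \<in> I. \<exists>j \<in> J i. Idl\<^bsub>B\<^esub> {h', mpoly_const (p j)} \<noteq> Idl\<^bsub>B\<^esub> {\<one>\<^bsub>B\<^esub>})"
proof -
  have R: "cring R" unfolding R_def by (rule cring_from_type_algebra)
  have B: "cring B" unfolding B_def by (rule cring_mpoly_ring)
  interpret B: cring B by (rule B)
  have \<kappa>: "mpoly_const \<in> ring_hom R B" unfolding R_def B_def by (rule mpoly_const_ring_hom)
  have const: "mpoly_const c \<in> carrier B" for c unfolding B_def by (rule mpoly_const_in_carrier)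
  have hB: "h \<in> carrier B" "h' \<in> carrier B"
    unfolding h_def h'_def B_def by (rule forcing_poly_in_carrier)+
  have h_eq: "h = mpoly_const d \<otimes>\<^bsub>B\<^esub> h'"
    unfolding h_def h'_def B_def mpoly_ring_simps(1) by (rule forcing_poly_scale[OF f' f\<^sub>0'])
  have "d \<noteq> 0" using nonzero f' by auto

  have prime: "primeideal (PIdl\<^bsub>B\<^esub> h') B"
    unfolding B_def h'_def
  proof (rule primeideal_PIdl_primitive_forcing_poly)
    show "\<exists>i\<in>{1..n}. f' i \<noteq> 0" using nonzero f' by auto
    fix q :: 'a assume q: "prime_elem q"
    show "\<exists>x\<in>insert f\<^sub>0' (f' ` {1..n}). \<not> q dvd x"
    proof (rule ccontr)
      assume "\<not> ?thesis"
      then have "\<forall>a \<in> insert f\<^sub>0 (f ` {1..n}). d * q dvd a" using f' f\<^sub>0' by auto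
      \<comment> \<open>A further common prime factor would contradict the choice of \<open>d\<close>.\<close>
      then have "d * q dvd d * 1" using greatest by auto
      then show False using \<open>d \<noteq> 0\<close> q by (auto dest: prime_elem_not_unit)
    qed
  qed
  let ?S = "vanishing_set B {h'}"
  have S: "connectedin (zariski B) ?S" "closedin (zariski B) ?S" "?S \<noteq> {}"
  proof -
    have eq: "vanishing_set B (PIdl\<^bsub>B\<^esub> h') = ?S"
      by (rule vanishing_set_cgenideal[OF B hB(2)])
    show "connectedin (zariski B) ?S"
      using connectedin_vanishing_set_primeideal[OF prime] unfolding eq .
    show "closedin (zariski B) ?S"
      unfolding closedin_zariski using hB(2) by (intro exI[of _ "{h'}"]) simp
    have "PIdl\<^bsub>B\<^esub> h' \<in> vanishing_set B (PIdl\<^bsub>B\<^esub> h')"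
      using prime by (simp add: vanishing_set_def Spec_def)
    then show "?S \<noteq> {}" unfolding eq by blast
  qed
  define \<pi> where "\<pi> = Spec_map R (mpoly_const :: 'a \<Rightarrow> _)"
  \<comment> \<open>The preimage under the projection from affine space.\<close>
  define pre where "pre C = {P \<in> Spec B. \<pi> P \<in> C}" for C
  have cont: "continuous_map (zariski B) (zariski R) \<pi>"
    unfolding \<pi>_def by (rule continuous_map_Spec_map[OF R B \<kappa>])
  have pre_V: "pre (vanishing_set R {c}) = vanishing_set B {mpoly_const c}" for c
    using Spec_map_vanishing_set_iff[OF R B \<kappa>, of _ "{c}"]
    unfolding pre_def \<pi>_def by (auto simp: vanishing_set_def R_def coeff_ring_simps)
  have pre_UN: "pre (\<Union>j\<in>A. C j) = (\<Union>j\<in>A. pre (C j))" for A :: "nat set" and C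
    unfolding pre_def by blast
  let ?Vd = "vanishing_set R {d}" and ?C = "\<lambda>i. \<Union>j\<in>J i. vanishing_set R {p j}"
  define K where "K = connected_components_of (subtopology (zariski R) ?Vd)"
  have K: "K = ?C ` I" unfolding K_def by (rule components)
  have Vd: "closedin (zariski R) ?Vd"
    unfolding closedin_zariski by (intro exI[of _ "{d}"]) (simp add: R_def coeff_ring_simps)
  have UK: "\<Union>K = ?Vd"
    unfolding K_def Union_connected_components_of using closedin_subset[OF Vd] by auto
  have J: "J i \<subseteq> {1..k}" if "i \<in> I" for i using partition(2) that by blast
  have pre_K: "connectedin (zariski B) (pre C)" "closedin (zariski B) (pre C)" "pre C \<noteq> {}"
    if "C \<in> K" for C
  proof -
    obtain i where i: "i \<in> I" "C = ?C i" using \<open>C \<in> K\<close> unfolding K by blast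
    have C: "C \<noteq> {}" "connectedin (zariski R) C"
      using nonempty_connected_components_of[OF that[unfolded K_def]]
        connectedin_connected_components_of[OF that[unfolded K_def]]
      by (simp_all add: connectedin_subtopology)
    have pre_C: "pre C = (\<Union>j\<in>J i. vanishing_set B {mpoly_const (p j)})"
      unfolding i(2) pre_UN pre_V ..
    have p: "prime_elem (p j)" if "j \<in> J i" for j using primes J[OF i(1)] that by blast
    show "connectedin (zariski B) (pre C)"
      unfolding pre_C using connectedin_preimage_union_vanishing_sets[of "J i" p n, OF p] C
      unfolding i(2) B_def R_def by blast
    have "closedin (zariski R) C"
      using closedin_connected_components_of \<open>C \<in> K\<close> Vd unfolding K_def
      by (blast intro: closedin_trans_full)
    then show "closedin (zariski B) (pre C)"
      using closedin_continuous_map_preimage[OF cont] unfolding pre_def topspace_zariski by blast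
    obtain j where j: "j \<in> J i" using C(1) i(2) by blast
    have "primeideal (PIdl\<^bsub>B\<^esub> (mpoly_const (p j))) B"
      unfolding B_def by (rule primeideal_PIdl_mpoly_const[OF p[OF j]])
    then have "PIdl\<^bsub>B\<^esub> (mpoly_const (p j)) \<in> vanishing_set B (PIdl\<^bsub>B\<^esub> (mpoly_const (p j)))"
      by (simp add: vanishing_set_def Spec_def)
    then show "pre C \<noteq> {}"
      unfolding pre_C vanishing_set_cgenideal[OF B const] using j by blast
  qed
  have conn_iff: "connectedin (zariski B) (?S \<union> \<Union>(pre ` K)) \<longleftrightarrow> (\<forall>C\<in>pre ` K. C \<inter> ?S \<noteq> {})"
  proof (rule connectedin_Un_disjoint_closed_iff[OF S])
    \<comment> \<open>Finiteness comes from the sets \<open>J i \<subseteq> {1..k}\<close>, not from the index set.\<close>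
    have "finite (J ` I)"
      by (rule finite_subset[of _ "Pow {1..k}"]) (use J in auto)
    moreover have "K = (\<lambda>A. \<Union>j\<in>A. vanishing_set R {p j}) ` J ` I"
      unfolding K image_image ..
    ultimately show "finite (pre ` K)" by simp
    have "pairwise disjnt K"
      unfolding K_def by (rule pairwise_disjoint_connected_components_of)
    then show "pairwise disjnt (pre ` K)"
      unfolding pairwise_def disjnt_def pre_def by blast
  qed (use pre_K in auto)
  \<comment> \<open>This is where \<open>h = d h'\<close> enters: a prime contains \<open>h\<close> iff it contains \<open>h'\<close> or \<open>d\<close>.\<close>
  have union: "vanishing_set B (PIdl\<^bsub>B\<^esub> h) = ?S \<union> \<Union>(pre ` K)"
  proof -
    have "\<Union>(pre ` K) = vanishing_set B {mpoly_const d}"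
      unfolding pre_V[symmetric] UK[symmetric] by (auto simp: pre_def)
    moreover have "h \<in> P \<longleftrightarrow> h' \<in> P \<or> mpoly_const d \<in> P" if "primeideal P B" for P
      using primeideal.I_prime[OF that const hB(2)] ideal.I_l_closed[OF primeideal.axioms(1)[OF that] _ const]
        ideal.I_r_closed[OF primeideal.axioms(1)[OF that] _ hB(2)]
      unfolding h_eq by blast
    ultimately show ?thesis
      unfolding vanishing_set_cgenideal[OF B hB(1)] by (auto simp: vanishing_set_def Spec_def)
  qed
  have meet: "pre (?C i) \<inter> ?S \<noteq> {} \<longleftrightarrow> (\<exists>j\<in>J i. Idl\<^bsub>B\<^esub> {h', mpoly_const (p j)} \<noteq> Idl\<^bsub>B\<^esub> {\<one>\<^bsub>B\<^esub>})" for i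
  proof -
    have "vanishing_set B {mpoly_const (p j)} \<inter> ?S \<noteq> {} \<longleftrightarrow>
        Idl\<^bsub>B\<^esub> {h', mpoly_const (p j)} \<noteq> Idl\<^bsub>B\<^esub> {\<one>\<^bsub>B\<^esub>}" for j
    proof -
      have "vanishing_set B {mpoly_const (p j)} \<inter> ?S = vanishing_set B {h', mpoly_const (p j)}"
        by (auto simp: vanishing_set_def)
      then show ?thesis
        using vanishing_set_eq_empty_iff[OF B, of "{h', mpoly_const (p j)}"] hB(2) const B.genideal_one
        by simp
    qed
    then show ?thesis unfolding pre_UN pre_V by blast
  qed
  have "connected_space (zariski (B Quot (PIdl\<^bsub>B\<^esub> h))) \<and>
      topspace (zariski (B Quot (PIdl\<^bsub>B\<^esub> h))) \<noteq> {} \<longleftrightarrow>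
      connectedin (zariski B) (?S \<union> \<Union>(pre ` K))"
    using connected_Spec_quotient_iff[OF B B.cgenideal_ideal[OF hB(1)]] S(3) unfolding union by blast
  also have "\<dots> \<longleftrightarrow> (\<forall>i\<in>I. pre (?C i) \<inter> ?S \<noteq> {})"
    unfolding conn_iff unfolding K by blast
  finally show ?thesis unfolding meet .
qed

end
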